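(* Let $p>2$ be a prime, let $t$ be a positive divisor of $p-1$, let $k>1$ be an integer and let $s\in\mathbb{N}$. Put $r=r_2(k)=\left\lfloor\frac{\log(p/2)}{8\log k}-\frac14\right\rfloor$. Then $$\#V(k,t,1)\le\max\left(2\tilde\Phi(k,s-1),\ \binom{r+s}{s}^{-1}t\right).$$
   Context: $\mathbb{F}_p$ is the field of residues modulo $p$. For $x\in\mathbb{F}_p$, the rational height is $\|x\|=\min\{\max(|a|,b)~:~a\in\mathbb{Z},\ b\in\mathbb{N},\ a\equiv bx \pmod p\}$. For $t\mid p-1$, $G$ is the unique subgroup of $\mathbb{F}_p^*$ of order $t$ and $V(k,t,1)=\{x\in G~:~\|x\|\le k\}$. $\Psi(x,y)$ is the number of positive integers $n\le x$ all of whose prime factors are at most $y$; $p_j$ is the $j$-th prime ($p_1=2$), with the convention $\Psi(x,p_0)=1$ for $x\ge 1$. For $m\in\mathbb{N}$, $\tilde\Phi(x,m)=\sum_{i=0}^{m}\binom{m}{i}\Psi(x,p_i)\Psi(x,p_{m-i})$, and $\tilde\Phi(x,0)=1$. *)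

theory Defs
  imports
    Complex_Main
    "HOL-Library.Extended_Real"
    "HOL-Library.Infinite_Set"
    "HOL-Number_Theory.Residues"
begin

text \<open>
  The field of residues modulo \<open>p\<close> is \<^term>\<open>residue_ring (int p)\<close>, with carrier \<open>{0..p-1}\<close>,
  and \<^term>\<open>mult_of (residue_ring (int p))\<close> is its multiplicative group.
\<close>

definition subgroup_of_order :: "nat \<Rightarrow> nat \<Rightarrow> int set" where
  "subgroup_of_order p t =
     (THE H. subgroup H (mult_of (residue_ring (int p))) \<and> card H = t)"

lemma ex1_subgroup_of_order:
  assumes p: "prime p" and t: "t dvd p - 1"
  shows "\<exists>!H. subgroup H (mult_of (residue_ring (int p))) \<and> card H = t"
proof -
  define R where "R = residue_ring (int p)"
  interpret R: residues_prime p R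
    by unfold_locales (use p in \<open>simp_all add: R_def\<close>)
  define M where "M = mult_of R"
  interpret M: group M
    unfolding M_def by (rule R.field_mult_group)
  have fin: "finite (carrier M)"
    unfolding M_def by (rule R.finite_mult_of[OF R.finite])
  have p1: "p > 1" using p prime_gt_1_nat by blast
  have ordM: "order M = p - 1"
    unfolding M_def R.order_mult_of[OF R.finite]
    using p1 by (simp add: order_def R.res_carrier_eq)
  have t0: "t > 0" using t p1 by (metis dvd_0_left_iff gr0I zero_less_diff not_less_iff_gr_or_eq)
  define T where "T = {x \<in> carrier M. x [^]\<^bsub>M\<^esub> t = \<one>\<^bsub>M\<^esub>}"
  have finT: "finite T" using fin by (simp add: T_def)
  have cT: "card T \<le> t"
  proof -
    have "card T \<le> card {x \<in> carrier R. x [^]\<^bsub>R\<^esub> t = \<one>\<^bsub>R\<^esub>}"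
      unfolding T_def M_def
      by (rule card_mono) (auto simp: nat_pow_mult_of)
    also have "\<dots> \<le> t" using R.num_roots_le_deg[OF R.finite] t0 by simp
    finally show ?thesis .
  qed
  have uniq: "H = T" if H: "subgroup H M" "card H = t" for H
  proof (rule card_subset_eq[OF finT])
    interpret H: group "M\<lparr>carrier := H\<rparr>"
      using H(1) by (rule M.subgroup_imp_group)
    have sub: "H \<subseteq> carrier M" using H(1) by (rule subgroup.subset)
    show HT: "H \<subseteq> T"
    proof
      fix x assume x: "x \<in> H"
      have "x [^]\<^bsub>M\<lparr>carrier := H\<rparr>\<^esub> order (M\<lparr>carrier := H\<rparr>) = \<one>\<^bsub>M\<lparr>carrier := H\<rparr>\<^esub>"
        using x by (intro H.pow_order_eq_1) simp
      then have "x [^]\<^bsub>M\<^esub> t = \<one>\<^bsub>M\<^esub>"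
        using H(2) by (simp add: order_def flip: M.nat_pow_consistent)
      then show "x \<in> T" using x sub by (auto simp: T_def)
    qed
    show "card H = card T"
      using card_mono[OF finT HT] cT H(2) by simp
  qed
  obtain a where a: "a \<in> carrier M" and gen: "carrier M = {a [^]\<^bsub>M\<^esub> i | i::nat. i \<in> UNIV}"
    using R.finite_field_mult_group_has_gen[OF R.finite]
    unfolding M_def nat_pow_mult_of by blast
  have "generate M {a} = carrier M"
    using M.generate_pow_on_finite_carrier[OF fin a] gen by simp
  then have orda: "M.ord a = p - 1"
    using M.generate_pow_card[OF a] ordM by (simp add: order_def)
  from t obtain d where d: "p - 1 = t * d" by (auto elim: dvdE)
  have d0: "d \<noteq> 0" using d p1 by (cases "d = 0") auto
  have "M.ord (a [^]\<^bsub>M\<^esub> d) = t"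
    using M.ord_pow[OF a, of d] orda d d0 by simp
  then have "card (generate M {a [^]\<^bsub>M\<^esub> d}) = t"
    using M.generate_pow_card[of "a [^]\<^bsub>M\<^esub> d"] a by simp
  moreover have "subgroup (generate M {a [^]\<^bsub>M\<^esub> d}) M"
    using a by (intro M.generate_is_subgroup) auto
  ultimately have "\<exists>!H. subgroup H M \<and> card H = t"
    using uniq by blast
  then show ?thesis by (simp add: M_def R_def)
qed

text \<open>The denominator \<open>b\<close> ranges over positive integers; otherwise \<open>a = b = 0\<close> would give height 0.\<close>

definition rat_height :: "nat \<Rightarrow> int \<Rightarrow> nat" where
  "rat_height p x =
     (LEAST h. h \<in> {max (nat \<bar>a\<bar>) b | (a::int) (b::nat). b > 0 \<and> [a = int b * x] (mod int p)})"

text \<open>This is \<open>V(k,t,1)\<close>.\<close>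

definition V :: "nat \<Rightarrow> nat \<Rightarrow> nat \<Rightarrow> int set" where
  "V p k t = {x \<in> subgroup_of_order p t. rat_height p x \<le> k}"

definition Psi :: "real \<Rightarrow> real \<Rightarrow> nat" where
  "Psi x y = card {n::nat. n > 0 \<and> real n \<le> x \<and> (\<forall>q. prime q \<and> q dvd n \<longrightarrow> real q \<le> y)}"

text \<open>\<^const>\<open>enumerate\<close> counts from 0, so the \<open>j\<close>-th prime \<open>p\<^sub>j\<close> has index \<open>j - 1\<close>.\<close>

definition nth_prime :: "nat \<Rightarrow> nat" where
  "nth_prime j = enumerate {q. prime q} (j - 1)"

text \<open>\<open>\<Psi>(x, p\<^sub>j)\<close>, with the convention \<open>\<Psi>(x, p\<^sub>0) = 1\<close> for \<open>x \<ge> 1\<close>.\<close>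

definition Psi_prime :: "real \<Rightarrow> nat \<Rightarrow> nat" where
  "Psi_prime x j = (if j = 0 then 1 else Psi x (real (nth_prime j)))"

definition Phi_tilde :: "real \<Rightarrow> nat \<Rightarrow> nat" where
  "Phi_tilde x m = (\<Sum>i=0..m. (m choose i) * Psi_prime x i * Psi_prime x (m - i))"

lemma Phi_tilde_0: "Phi_tilde x 0 = 1"
  by (simp add: Phi_tilde_def Psi_prime_def)

text \<open>
  For \<open>k > 1\<close> and \<open>p > 2\<close> the value is at least \<open>-1\<close>. If it is \<open>-1\<close>, then for \<open>s \<ge> 1\<close> the binomial
  coefficient of \<open>r + s\<close> over \<open>s\<close> is 0 and its inverse has to be read as \<open>\<infinity>\<close>, as in \<^typ>\<open>ereal\<close>.
\<close>

definition r2 :: "nat \<Rightarrow> nat \<Rightarrow> int" where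
  "r2 p k = \<lfloor>ln (real p / 2) / (8 * ln (real k)) - 1 / 4\<rfloor>"

end

theory Submission
  imports
    Defs
    "Jordan_Normal_Form.Determinant"
begin

text \<open>
  Represent the elements of \<open>V(k,t,1)\<close> by fractions with numerator and denominator at most \<open>k\<close> in
  absolute value, and consider the matrix of their valuations at the primes.

  If all its minors of order \<open>s\<close> vanish, then the valuations at some \<open>s - 1\<close> primes determine the
  valuations at all primes, so a fraction is determined by its sign, the set \<open>I\<close> of those primes with
  positive valuation, and the parts of the numerator and the denominator supported on \<open>I\<close> and on its
  complement. Counting these data gives twice the sum defining \<open>\<Phi>\<close>.

  Otherwise fix \<open>s\<close> primes with a nonzero minor and choose \<open>w\<^sub>1, \<dots>, w\<^sub>s\<close> with the largest possible
  minor in absolute value. By Cramer's rule every fraction then has coordinates in \<open>[-1, 1]\<close> with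
  respect to the \<open>w\<^sub>i\<close>. Hence the products of \<open>v\<close> and the powers \<open>w\<^sub>i\<close> to the \<open>4 e\<^sub>i\<close>, with
  \<open>e\<^sub>1 + \<dots> + e\<^sub>s \<le> r\<close>, are pairwise distinct fractions; since \<open>2 k ^ (8 r + 2) < p\<close>, they remain
  distinct modulo \<open>p\<close>, and they lie in the subgroup of order \<open>t\<close>.
\<close>

subsection \<open>Minors\<close>

text \<open>Lists instead of sets: a column can be replaced in place, and a repeated column simply
  gives 0.\<close>

definition minor :: "('q \<Rightarrow> 'v \<Rightarrow> int) \<Rightarrow> 'q list \<Rightarrow> 'v list \<Rightarrow> int" where
  "minor f qs ws = det (mat (length ws) (length ws) (\<lambda>(i, j). f (qs ! i) (ws ! j)))"

text \<open>Laplace expansion along column \<open>j\<close>: its cofactors do not see that column,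
  so the minor is linear in the values of \<open>f\<close> at \<open>v\<close>.\<close>

lemma minor_update:
  assumes j: "j < length ws"
  shows "minor f qs (ws[j := v]) =
    (\<Sum>i<length ws. f (qs ! i) v *
       cofactor (mat (length ws) (length ws) (\<lambda>(i, j). f (qs ! i) (ws ! j))) i j)"
proof -
  define n where "n = length ws"
  define A where "A = mat n n (\<lambda>(i, l). f (qs ! i) (ws ! l))"
  define M where "M = mat n n (\<lambda>(i, l). f (qs ! i) (ws[j := v] ! l))"
  have "mat_delete M i j = mat_delete A i j" for i
    unfolding M_def A_def mat_delete_def by (intro eq_matI) auto
  then have c: "cofactor M i j = cofactor A i j" for i
    by (simp add: cofactor_def)
  have "det M = (\<Sum>i<n. M $$ (i, j) * cofactor M i j)"
    by (rule laplace_expansion_column) (use j in \<open>auto simp: M_def n_def\<close>)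
  also have "\<dots> = (\<Sum>i<n. f (qs ! i) v * cofactor A i j)"
    unfolding c using j by (intro sum.cong) (auto simp: M_def n_def)
  finally show ?thesis by (simp add: minor_def M_def A_def n_def)
qed

lemma minor_update_nth_eq_0:
  assumes "j < length ws" "l < length ws" "l \<noteq> j"
  shows "minor f qs (ws[j := ws ! l]) = 0"
  unfolding minor_def
  by (rule det_identical_columns[of _ "length ws" j l]) (use assms in \<open>auto intro!: eq_vecI\<close>)

text \<open>Cramer's rule without division, for the difference of two columns: after expansion along
  column \<open>j\<close>, each term with \<open>l\<close> \<noteq> \<open>j\<close> is a minor with
  two equal columns.\<close>

lemma minor_cramer:
  fixes y :: "nat \<Rightarrow> int"
  assumes j: "j < length ws"
    and eq: "\<And>i. i < length ws \<Longrightarrow>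
      f (qs ! i) v - f (qs ! i) v' = (\<Sum>l<length ws. f (qs ! i) (ws ! l) * y l)"
  shows "minor f qs (ws[j := v]) - minor f qs (ws[j := v']) = y j * minor f qs ws"
proof -
  define n where "n = length ws"
  define c where "c i = cofactor (mat n n (\<lambda>(i, j). f (qs ! i) (ws ! j))) i j" for i
  have upd: "minor f qs (ws[j := u]) = (\<Sum>i<n. f (qs ! i) u * c i)" for u
    using minor_update[OF j, of f qs u] by (simp add: c_def n_def)
  have "minor f qs (ws[j := v]) - minor f qs (ws[j := v']) =
      (\<Sum>i<n. (\<Sum>l<n. f (qs ! i) (ws ! l) * y l) * c i)"
    unfolding upd sum_subtractf[symmetric] left_diff_distrib[symmetric]
    by (intro sum.cong) (auto simp: eq n_def)
  also have "\<dots> = (\<Sum>l<n. y l * minor f qs (ws[j := ws ! l]))"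
    unfolding upd sum_distrib_left sum_distrib_right
    by (subst sum.swap) (simp add: mult_ac)
  also have "\<dots> = (\<Sum>l<n. if l = j then y j * minor f qs ws else 0)"
    using j by (intro sum.cong) (auto simp: minor_update_nth_eq_0 n_def)
  also have "\<dots> = y j * minor f qs ws"
    using j by (simp add: n_def)
  finally show ?thesis .
qed

text \<open>The two bordered matrices agree outside the last column, and there they differ only in
  the corner, whose cofactor is the old minor.\<close>

lemma minor_snoc_diff:
  assumes len: "length qs = length ws"
    and eq: "\<And>q. q \<in> set qs \<Longrightarrow> f q v = f q v'"
  shows "minor f (qs @ [q]) (ws @ [v]) - minor f (qs @ [q]) (ws @ [v']) =
    (f q v - f q v') * minor f qs ws"
proof -
  define n where "n = length ws"
  define A where "A = mat (Suc n) (Suc n) (\<lambda>(i, j). f ((qs @ [q]) ! i) ((ws @ [v]) ! j))"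
  have upd: "minor f (qs @ [q]) (ws @ [u]) =
      (\<Sum>i<Suc n. f ((qs @ [q]) ! i) u * cofactor A i n)" for u
    using minor_update[of n "ws @ [v]" f "qs @ [q]" u] by (simp add: A_def n_def)
  have "mat_delete A n n = mat n n (\<lambda>(i, j). f (qs ! i) (ws ! j))"
    unfolding A_def mat_delete_def
    by (rule eq_matI) (auto simp: n_def len nth_append)
  then have cof: "cofactor A n n = minor f qs ws"
    by (simp add: cofactor_def minor_def n_def)
  have "(\<Sum>i<n. f ((qs @ [q]) ! i) v * cofactor A i n) =
      (\<Sum>i<n. f ((qs @ [q]) ! i) v' * cofactor A i n)"
    using eq by (intro sum.cong) (auto simp: nth_append len n_def)
  then show ?thesis
    unfolding upd by (simp add: cof nth_append len flip: n_def left_diff_distrib)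
qed

text \<open>Either, for some order below \<open>s\<close>, there is a nonzero minor while all minors
  of the next order vanish, and its rows determine all others; or a nonzero minor of order
  \<open>s\<close> is maximized over its columns. Cramer's quotients then lie in [-1, 1], so the
  difference of two is at most 2.\<close>

lemma minor_dichotomy:
  fixes f :: "'q \<Rightarrow> 'v \<Rightarrow> int"
  assumes fin: "finite W"
  obtains
    (determined) Q where "finite Q" "Q \<subseteq> P" "card Q < s"
      "\<And>v v' q. \<lbrakk>v \<in> W; v' \<in> W; q \<in> P; \<And>q'. q' \<in> Q \<Longrightarrow> f q' v = f q' v'\<rbrakk> \<Longrightarrow> f q v = f q v'"
  | (independent) ws where "length ws = s" "set ws \<subseteq> W"
      "\<And>v v' y j. \<lbrakk>v \<in> W; v' \<in> W; j < s;
         \<And>q. q \<in> P \<Longrightarrow> f q v - f q v' = (\<Sum>l<s. f q (ws ! l) * y l)\<rbrakk> \<Longrightarrow> \<bar>y j\<bar> \<le> 2"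
proof -
  define good where "good n \<longleftrightarrow> (\<exists>qs ws. length qs = n \<and> length ws = n \<and> set qs \<subseteq> P \<and>
    set ws \<subseteq> W \<and> minor f qs ws \<noteq> 0)" for n
  show thesis
  proof (cases "good s")
    case True
    then obtain qs ws0 where qs: "length qs = s" "set qs \<subseteq> P"
      and ws0: "length ws0 = s" "set ws0 \<subseteq> W" "minor f qs ws0 \<noteq> 0"
      unfolding good_def by blast
    \<comment> \<open>The rows \<open>qs\<close> stay fixed; only the columns vary, over a finite
      set because \<open>W\<close> is finite.\<close>
    define T where "T = {ws. set ws \<subseteq> W \<and> length ws = s}"
    have "finite T" unfolding T_def by (rule finite_lists_length_eq[OF fin])
    moreover have "ws0 \<in> T" using ws0 by (simp add: T_def)
    ultimately obtain ws where ws: "ws \<in> T"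
      and max: "\<And>us. us \<in> T \<Longrightarrow> \<bar>minor f qs us\<bar> \<le> \<bar>minor f qs ws\<bar>"
      using obtains_MAX[of T "\<lambda>us. \<bar>minor f qs us\<bar>"]
      by (metis Max_ge empty_iff finite_imageI image_eqI)
    have nz: "\<bar>minor f qs ws\<bar> > 0" using max[OF \<open>ws0 \<in> T\<close>] ws0(3) by linarith
    have len: "length ws = s" and sub: "set ws \<subseteq> W" using ws by (auto simp: T_def)
    show thesis
    proof (rule independent[OF len sub])
      fix v v' y j
      assume v: "v \<in> W" "v' \<in> W" and j: "j < s"
        and eq: "\<And>q. q \<in> P \<Longrightarrow> f q v - f q v' = (\<Sum>l<s. f q (ws ! l) * y l)"
      have T: "ws[j := u] \<in> T" if "u \<in> W" for u
        using that sub len set_update_subset_insert[of ws j u] by (auto simp: T_def)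
      have "minor f qs (ws[j := v]) - minor f qs (ws[j := v']) = y j * minor f qs ws"
      proof (rule minor_cramer)
        show "f (qs ! i) v - f (qs ! i) v' = (\<Sum>l<length ws. f (qs ! i) (ws ! l) * y l)"
          if "i < length ws" for i
          using that qs len by (subst eq) (auto simp: subset_iff)
      qed (use j len in simp)
      then have "\<bar>y j\<bar> * \<bar>minor f qs ws\<bar> \<le> 2 * \<bar>minor f qs ws\<bar>"
        using max[OF T[OF v(1)]] max[OF T[OF v(2)]] unfolding abs_mult[symmetric] by linarith
      then show "\<bar>y j\<bar> \<le> 2" using nz by (simp add: mult_le_cancel_right)
    qed
  next
    case False
    \<comment> \<open>The empty determinant is 1, so the climb from order 0 to \<open>s\<close> must
      break at some \<open>m\<close>.\<close>
    have "good 0" by (simp add: good_def minor_def)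
    have "\<exists>m<s. good m \<and> \<not> good (Suc m)"
    proof (rule ccontr)
      assume none: "\<not> ?thesis"
      have "good n" if "n \<le> s" for n
        using that by (induction n) (use \<open>good 0\<close> none in \<open>auto simp: Suc_le_eq\<close>)
      then show False using False by blast
    qed
    then obtain m where m: "m < s" "good m" "\<not> good (Suc m)" by blast
    obtain qs ws where qs: "length qs = m" "set qs \<subseteq> P"
      and ws: "length ws = m" "set ws \<subseteq> W" "minor f qs ws \<noteq> 0"
      using m(2) unfolding good_def by blast
    show thesis
    proof (rule determined[of "set qs"])
      show "card (set qs) < s" using card_length[of qs] qs m by linarith
      fix v v' q
      assume v: "v \<in> W" "v' \<in> W" and q: "q \<in> P"
        and eq: "\<And>q'. q' \<in> set qs \<Longrightarrow> f q' v = f q' v'"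
      have 0: "minor f (qs @ [q]) (ws @ [u]) = 0" if "u \<in> W" for u
      proof (rule ccontr)
        assume "\<not> ?thesis"
        then have "good (Suc m)"
          unfolding good_def using that q qs ws
          by (intro exI[of _ "qs @ [q]"] exI[of _ "ws @ [u]"]) auto
        then show False using m by simp
      qed
      have "(f q v - f q v') * minor f qs ws = 0"
        using minor_snoc_diff[of qs ws f v v' q] 0 v eq qs ws by simp
      then show "f q v = f q v'" using ws(3) by simp
    qed (use qs in auto)
  qed
qed

subsection \<open>Smooth numbers\<close>

definition smooth_upto :: "nat \<Rightarrow> nat set \<Rightarrow> nat set" where
  "smooth_upto k S = {n. 0 < n \<and> n \<le> k \<and> prime_factors n \<subseteq> S}"

lemma finite_smooth_upto: "finite (smooth_upto k S)"
  by (rule finite_subset[of _ "{..k}"]) (auto simp: smooth_upto_def)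

text \<open>Elements of \<open>I\<close> below \<open>q\<close> are also elements of
  \<open>S\<close> below \<open>q\<close>, so the rank of \<open>q\<close> in \<open>I\<close> is at
  most its rank in \<open>S\<close>.\<close>

lemma enumerate_card_below_le:
  fixes S I :: "nat set"
  assumes S: "infinite S" and IS: "I \<subseteq> S" and q: "q \<in> I"
  shows "enumerate S (card {x \<in> I. x < q}) \<le> q"
proof -
  obtain n where n: "enumerate S n = q"
    using enumerate_Ex[OF S] IS q by blast
  have "{x \<in> I. x < q} \<subseteq> enumerate S ` {..<n}"
  proof
    fix x assume x: "x \<in> {x \<in> I. x < q}"
    then obtain i where i: "enumerate S i = x" using enumerate_Ex[OF S] IS by blast
    then have "i < n" using x n S by (metis (no_types, lifting) enumerate_mono_iff mem_Collect_eq)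
    then show "x \<in> enumerate S ` {..<n}" using i by blast
  qed
  then have "card {x \<in> I. x < q} \<le> n"
    by (metis card_lessThan finite_lessThan surj_card_le)
  then show ?thesis using n S by (metis enumerate_mono_le_iff)
qed

lemma eq_prod_prime_powers:
  fixes n :: nat
  assumes "finite I" "\<And>q. q \<in> I \<Longrightarrow> prime q" "0 < n" "prime_factors n \<subseteq> I"
  shows "n = (\<Prod>q\<in>I. q ^ multiplicity q n)"
proof (rule multiplicity_eq_nat)
  show "multiplicity q n = multiplicity q (\<Prod>q\<in>I. q ^ multiplicity q n)" if "prime q" for q
    using assms that
    by (subst multiplicity_prod_prime_powers)
       (auto simp: subset_iff in_prime_factors_iff intro!: not_dvd_imp_multiplicity_0)
qed (use assms prime_gt_0_nat in \<open>auto intro!: prod_pos\<close>)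

text \<open>Replacing the primes of \<open>I\<close>, in increasing order, by the smallest primes makes no number larger.\<close>

lemma card_smooth_upto_le:
  assumes fin: "finite I" and pr: "\<And>q. q \<in> I \<Longrightarrow> prime q"
  shows "card (smooth_upto k I) \<le> Psi_prime (real k) (card I)"
proof (cases "I = {}")
  case True
  have "smooth_upto k I \<subseteq> {1}"
    using True by (auto simp: smooth_upto_def prime_factorization_empty_iff)
  then have "card (smooth_upto k I) \<le> card {1::nat}" by (intro card_mono) auto
  then show ?thesis using True by (simp add: Psi_prime_def)
next
  case False
  define P where "P = {q::nat. prime q}"
  have P: "infinite P" unfolding P_def by (rule primes_infinite)
  define pos where "pos q = card {x \<in> I. x < q}" for q
  define g where "g q = enumerate P (pos q)" for q
  have pos: "pos q < pos q'" if "q \<in> I" "q < q'" for q q'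
    unfolding pos_def using that fin by (intro psubset_card_mono) auto
  have inj: "inj_on g I"
  proof (rule inj_onI)
    fix a b assume ab: "a \<in> I" "b \<in> I" "g a = g b"
    then have "pos a = pos b" using P by (simp add: g_def inj_enumerate[OF P] inj_eq)
    then show "a = b" using pos[of a b] pos[of b a] ab by (metis less_irrefl linorder_neqE_nat)
  qed
  have gp: "prime (g q)" for q
    using enumerate_in_set[OF P] by (auto simp: g_def P_def)
  have gle: "g q \<le> q" if "q \<in> I" for q
    unfolding g_def pos_def using that pr by (intro enumerate_card_below_le[OF P]) (auto simp: P_def)
  have glast: "g q \<le> nth_prime (card I)" if "q \<in> I" for q
  proof -
    \<comment> \<open>Ranks count from 0, so \<open>pos q\<close> is at most
      \<open>card I - 1\<close>, the index of \<open>nth_prime (card I)\<close> in the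
      enumeration.\<close>
    have "pos q < card I" unfolding pos_def using that fin by (intro psubset_card_mono) auto
    then show ?thesis using P unfolding g_def nth_prime_def P_def[symmetric] by simp
  qed
  define h where "h n = (\<Prod>q\<in>I. g q ^ multiplicity q n)" for n :: nat
  \<comment> \<open>Reindexed by the image of \<open>g\<close>, the product runs over distinct
    primes, so its multiplicities can be read off and \<open>h\<close> turns out injective.\<close>
  have h_alt: "h n = (\<Prod>u\<in>g ` I. u ^ multiplicity (the_inv_into I g u) n)" for n
    unfolding h_def by (simp add: prod.reindex[OF inj] the_inv_into_f_f[OF inj])
  have mh: "multiplicity (g q) (h n) = multiplicity q n" if "q \<in> I" for q n
    unfolding h_alt using that fin gp
    by (subst multiplicity_prod_prime_powers) (auto simp: the_inv_into_f_f[OF inj])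
  have eq: "n = (\<Prod>q\<in>I. q ^ multiplicity q n)" if "n \<in> smooth_upto k I" for n
    using that by (intro eq_prod_prime_powers[OF fin pr]) (auto simp: smooth_upto_def)
  define T where "T = {n. n > 0 \<and> real n \<le> real k \<and>
    (\<forall>q. prime q \<and> q dvd n \<longrightarrow> real q \<le> real (nth_prime (card I)))}"
  have "card (smooth_upto k I) \<le> card T"
  proof (rule card_inj_on_le)
    show "inj_on h (smooth_upto k I)"
    proof (rule inj_onI)
      fix a b assume ab: "a \<in> smooth_upto k I" "b \<in> smooth_upto k I" "h a = h b"
      have "a = (\<Prod>q\<in>I. q ^ multiplicity q a)" by (rule eq[OF ab(1)])
      also have "\<dots> = (\<Prod>q\<in>I. q ^ multiplicity q b)"
        using mh ab(3) by (intro prod.cong) (auto, metis)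
      also have "\<dots> = b" by (rule eq[OF ab(2), symmetric])
      finally show "a = b" .
    qed
    show "finite T" by (rule finite_subset[of _ "{..k}"]) (auto simp: T_def)
    show "h ` smooth_upto k I \<subseteq> T"
    proof safe
      fix n assume n: "n \<in> smooth_upto k I"
      have "h n \<le> (\<Prod>q\<in>I. q ^ multiplicity q n)"
        unfolding h_def by (intro prod_mono) (auto intro: power_mono gle)
      also have "\<dots> = n" by (rule eq[OF n, symmetric])
      also have "n \<le> k" using n by (simp add: smooth_upto_def)
      finally have "h n \<le> k" .
      moreover have "h n > 0" unfolding h_def using gp prime_gt_0_nat by (intro prod_pos) auto
      moreover have "u \<le> nth_prime (card I)" if u: "prime u" "u dvd h n" for u
      proof -
        obtain q where q: "q \<in> I" "u dvd g q ^ multiplicity q n"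
          using u fin unfolding h_def by (auto simp: prime_dvd_prod_iff)
        then have "u dvd g q" using u prime_dvd_power by blast
        then have "u = g q" using u gp primes_dvd_imp_eq by blast
        then show ?thesis using glast q by simp
      qed
      ultimately show "h n \<in> T" by (auto simp: T_def)
    qed
  qed
  then show ?thesis
    using False fin by (simp add: Psi_prime_def Psi_def T_def)
qed

lemma sum_Pow_by_card:
  fixes g :: "nat \<Rightarrow> nat"
  assumes "finite Q"
  shows "(\<Sum>I\<in>Pow Q. g (card I)) = (\<Sum>i=0..card Q. (card Q choose i) * g i)"
proof -
  have "(\<Sum>I\<in>Pow Q. g (card I)) = (\<Sum>i\<in>{0..card Q}. \<Sum>I\<in>{I \<in> Pow Q. card I = i}. g (card I))"
    using assms by (intro sum.group[symmetric]) (auto intro: card_mono)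
  also have "\<dots> = (\<Sum>i=0..card Q. (card Q choose i) * g i)"
    using n_subsets[OF assms] by (intro sum.cong) auto
  finally show ?thesis .
qed

text \<open>The source of the binomial coefficient and the two \<open>Psi_prime\<close> factors in
  \<open>Phi_tilde\<close>: the sets \<open>I\<close> are grouped by size, and each smooth count is
  bounded by the one for the smallest primes.\<close>

lemma card_split_smooth_le:
  assumes fin: "finite Q" and pr: "\<And>q. q \<in> Q \<Longrightarrow> prime q"
  shows "card (SIGMA I:Pow Q. smooth_upto k I \<times> smooth_upto k (Q - I)) \<le> Phi_tilde (real k) (card Q)"
proof -
  have "card (SIGMA I:Pow Q. smooth_upto k I \<times> smooth_upto k (Q - I)) =
      (\<Sum>I\<in>Pow Q. card (smooth_upto k I) * card (smooth_upto k (Q - I)))"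
    using fin by (subst card_SigmaI) (auto simp: finite_smooth_upto card_cartesian_product)
  also have "\<dots> \<le> (\<Sum>I\<in>Pow Q. Psi_prime (real k) (card I) * Psi_prime (real k) (card Q - card I))"
  proof (intro sum_mono mult_mono)
    fix I assume "I \<in> Pow Q"
    then have I: "I \<subseteq> Q" "finite I" using fin finite_subset by auto
    show "card (smooth_upto k I) \<le> Psi_prime (real k) (card I)"
      using I pr by (intro card_smooth_upto_le) auto
    show "card (smooth_upto k (Q - I)) \<le> Psi_prime (real k) (card Q - card I)"
      using I pr fin card_smooth_upto_le[of "Q - I" k] by (auto simp: card_Diff_subset)
  qed auto
  also have "\<dots> = Phi_tilde (real k) (card Q)"
    unfolding Phi_tilde_def
    by (subst sum_Pow_by_card[OF fin, where g = "\<lambda>i. Psi_prime (real k) i * Psi_prime (real k) (card Q - i)"])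
       (simp add: mult.assoc)
  finally show ?thesis .
qed

subsection \<open>Valuations of fractions\<close>

text \<open>The \<open>q\<close>-adic valuation of \<open>a / b\<close> for prime \<open>q\<close>
  and nonzero \<open>a\<close>, \<open>b\<close>; the sign is lost.\<close>

definition frac_val :: "nat \<Rightarrow> int \<Rightarrow> int \<Rightarrow> int" where
  "frac_val q a b = int (multiplicity q (nat \<bar>a\<bar>)) - int (multiplicity q (nat \<bar>b\<bar>))"

lemma multiplicity_nat_abs_mult:
  assumes "prime q" "a \<noteq> 0" "b \<noteq> 0"
  shows "multiplicity q (nat \<bar>a * b\<bar>) = multiplicity q (nat \<bar>a\<bar>) + multiplicity q (nat \<bar>b\<bar>)"
  using assms by (simp add: abs_mult nat_mult_distrib prime_elem_multiplicity_mult_distrib)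

lemma frac_val_mult:
  assumes "prime q" "a \<noteq> 0" "b \<noteq> 0" "c \<noteq> 0" "d \<noteq> 0"
  shows "frac_val q (a * c) (b * d) = frac_val q a b + frac_val q c d"
  using assms by (simp add: frac_val_def multiplicity_nat_abs_mult)

lemma frac_val_power:
  assumes "prime q" "a \<noteq> 0" "b \<noteq> 0"
  shows "frac_val q (a ^ n) (b ^ n) = int n * frac_val q a b"
proof (induction n)
  case 0
  then show ?case by (simp add: frac_val_def)
next
  case (Suc n)
  then show ?case using assms by (simp add: frac_val_mult algebra_simps)
qed

lemma frac_val_prod:
  assumes "prime q" "\<And>i. i \<in> S \<Longrightarrow> a i \<noteq> 0" "\<And>i. i \<in> S \<Longrightarrow> b i \<noteq> 0" "finite S"
  shows "frac_val q (\<Prod>i\<in>S. a i) (\<Prod>i\<in>S. b i) = (\<Sum>i\<in>S. frac_val q (a i) (b i))"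
  using assms(4,2,3)
proof (induction S rule: finite_induct)
  case empty
  then show ?case by (simp add: frac_val_def)
next
  case (insert x F)
  then show ?case using assms(1) by (simp add: frac_val_mult)
qed

lemma frac_val_eq_of_cross_eq:
  assumes "prime q" "a \<noteq> 0" "b \<noteq> 0" "c \<noteq> 0" "d \<noteq> 0" "a * d = c * b"
  shows "frac_val q a b = frac_val q c d"
  using multiplicity_nat_abs_mult[of q a d] multiplicity_nat_abs_mult[of q c b] assms
  by (simp add: frac_val_def)

text \<open>Unique factorization: the valuations determine a fraction up to sign.\<close>

lemma cross_abs_eq_of_frac_val_eq:
  assumes "a \<noteq> 0" "b \<noteq> 0" "c \<noteq> 0" "d \<noteq> 0"
    and "\<And>q. prime q \<Longrightarrow> frac_val q a b = frac_val q c d"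
  shows "\<bar>a * d\<bar> = \<bar>c * b\<bar>"
proof -
  have "nat \<bar>a * d\<bar> = nat \<bar>c * b\<bar>"
  proof (rule multiplicity_eq_nat)
    show "multiplicity q (nat \<bar>a * d\<bar>) = multiplicity q (nat \<bar>c * b\<bar>)" if "prime q" for q
      using assms(1-4) assms(5)[OF that] that by (simp add: multiplicity_nat_abs_mult frac_val_def)
  qed (use assms in auto)
  then show ?thesis by linarith
qed

lemma prod_prime_powers_dvd:
  fixes n :: nat
  assumes "finite S" "\<And>q. q \<in> S \<Longrightarrow> prime q" "\<And>q. q \<in> S \<Longrightarrow> e q \<le> multiplicity q n" "n > 0"
  shows "(\<Prod>q\<in>S. q ^ e q) dvd n"
proof (rule multiplicity_le_imp_dvd)
  show "multiplicity q (\<Prod>q\<in>S. q ^ e q) \<le> multiplicity q n" if "prime q" for q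
    using assms that by (subst multiplicity_prod_prime_powers) auto
qed (use assms prime_gt_0_nat in \<open>auto simp: prod_zero_iff\<close>)

lemma prod_prime_powers_in_smooth_upto:
  assumes "finite S" "\<And>q. q \<in> S \<Longrightarrow> prime q" "\<And>q. q \<in> S \<Longrightarrow> e q \<le> multiplicity q n"
    and "n > 0" "n \<le> k"
  shows "(\<Prod>q\<in>S. q ^ e q) \<in> smooth_upto k S"
proof -
  have "(\<Prod>q\<in>S. q ^ e q) \<le> k"
    using dvd_imp_le[OF prod_prime_powers_dvd[OF assms(1-4)]] assms(4,5) by linarith
  moreover have "(\<Prod>q\<in>S. q ^ e q) > 0"
    using assms prime_gt_0_nat by (intro prod_pos) auto
  moreover have "prime_factors (\<Prod>q\<in>S. q ^ e q) \<subseteq> S"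
  proof
    fix u assume "u \<in> prime_factors (\<Prod>q\<in>S. q ^ e q)"
    then have u: "prime u" "multiplicity u (\<Prod>q\<in>S. q ^ e q) > 0"
      by (auto simp: prime_factors_multiplicity)
    then show "u \<in> S"
      using assms(1,2) by (auto simp: multiplicity_prod_prime_powers split: if_splits)
  qed
  ultimately show ?thesis by (simp add: smooth_upto_def)
qed

text \<open>Fractions \<open>A x / B x\<close> of height at most \<open>k\<close>, not necessarily
  reduced, which are distinct rationals by \<open>frac_inj\<close>. The sign sits in the
  numerator.\<close>

locale bounded_fractions =
  fixes W :: "'v set" and A B :: "'v \<Rightarrow> int" and k :: nat
  assumes finite_W: "finite W"
    and num: "x \<in> W \<Longrightarrow> A x \<noteq> 0" "x \<in> W \<Longrightarrow> \<bar>A x\<bar> \<le> int k"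
    and den: "x \<in> W \<Longrightarrow> 0 < B x" "x \<in> W \<Longrightarrow> B x \<le> int k"
    and frac_inj: "\<lbrakk>x \<in> W; y \<in> W; A x * B y = A y * B x\<rbrakk> \<Longrightarrow> x = y"
begin

section \<open>Counting fractions determined by few primes\<close>

abbreviation val :: "nat \<Rightarrow> 'v \<Rightarrow> int" where
  "val q x \<equiv> frac_val q (A x) (B x)"

lemma den_nonzero: "x \<in> W \<Longrightarrow> B x \<noteq> 0"
  using den(1) by fastforce

text \<open>The sign gives the factor 2. The remaining data are \<open>pos x\<close> and the parts
  \<open>n1\<close>, \<open>n2\<close> at \<open>Q\<close> of the reduced numerator and denominator,
  from which all valuations on \<open>Q\<close>, hence everywhere, are recovered.\<close>

lemma card_le_Phi_tilde:
  assumes finQ: "finite Q" and pr: "\<And>q. q \<in> Q \<Longrightarrow> prime q"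
    and det: "\<And>x y q. \<lbrakk>x \<in> W; y \<in> W; prime q; \<And>q'. q' \<in> Q \<Longrightarrow> val q' x = val q' y\<rbrakk>
      \<Longrightarrow> val q x = val q y"
  shows "card W \<le> 2 * Phi_tilde (real k) (card Q)"
proof -
  define pos where "pos x = {q \<in> Q. val q x > 0}" for x
  define n1 where "n1 x = (\<Prod>q\<in>pos x. q ^ nat (val q x))" for x
  \<comment> \<open>Primes of valuation 0 fall on the denominator side, where they contribute
    exponent 0.\<close>
  define n2 where "n2 x = (\<Prod>q\<in>Q - pos x. q ^ nat (- val q x))" for x
  define T where "T = (SIGMA I:Pow Q. smooth_upto k I \<times> smooth_upto k (Q - I))"
  have fin: "finite (pos x)" "finite (Q - pos x)" for x using finQ by (auto simp: pos_def)
  have prp: "prime q" if "q \<in> pos x \<or> q \<in> Q - pos x" for q x using that pr by (auto simp: pos_def)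
  have val_eq: "val q x = (if q \<in> pos x then int (multiplicity q (n1 x)) else - int (multiplicity q (n2 x)))"
    if "q \<in> Q" for q x
  proof (cases "q \<in> pos x")
    case True
    then have "multiplicity q (n1 x) = nat (val q x)"
      unfolding n1_def using fin prp pr that by (subst multiplicity_prod_prime_powers) auto
    then show ?thesis using True by (simp add: pos_def)
  next
    case False
    then have "multiplicity q (n2 x) = nat (- val q x)"
      unfolding n2_def using fin prp pr that by (subst multiplicity_prod_prime_powers) auto
    then show ?thesis using False that by (simp add: pos_def)
  qed
  define F where "F x = (A x > 0, pos x, n1 x, n2 x)" for x
  have "card W \<le> card ((UNIV :: bool set) \<times> T)"
  proof (rule card_inj_on_le)
    show "finite ((UNIV :: bool set) \<times> T)"
      using finQ by (auto simp: T_def finite_smooth_upto)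
    show "F ` W \<subseteq> UNIV \<times> T"
    proof
      fix z assume "z \<in> F ` W"
      then obtain x where x: "x \<in> W" and z: "z = F x" by blast
      have "n1 x \<in> smooth_upto k (pos x)"
        unfolding n1_def
      proof (rule prod_prime_powers_in_smooth_upto[where n = "nat \<bar>A x\<bar>"])
        \<comment> \<open>Cancellation in the fraction only lowers the exponent of
          \<open>q\<close>.\<close>
        show "nat (val q x) \<le> multiplicity q (nat \<bar>A x\<bar>)" for q by (simp add: frac_val_def)
      qed (use fin prp num[OF x] in auto)
      moreover have "n2 x \<in> smooth_upto k (Q - pos x)"
        unfolding n2_def
      proof (rule prod_prime_powers_in_smooth_upto[where n = "nat \<bar>B x\<bar>"])
        show "nat (- val q x) \<le> multiplicity q (nat \<bar>B x\<bar>)" for q by (simp add: frac_val_def)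
      qed (use fin prp den[OF x] in auto)
      ultimately show "z \<in> UNIV \<times> T" by (auto simp: z F_def T_def pos_def)
    qed
    show "inj_on F W"
    proof (rule inj_onI)
      fix x y assume xy: "x \<in> W" "y \<in> W" and eq: "F x = F y"
      have "val q x = val q y" if "q \<in> Q" for q
        using eq by (simp only: val_eq[OF that] F_def prod.inject)
      then have "val q x = val q y" if "prime q" for q
        using det[OF xy that] by blast
      then have "\<bar>A x * B y\<bar> = \<bar>A y * B x\<bar>"
        using xy num(1) den_nonzero by (intro cross_abs_eq_of_frac_val_eq) auto
      then have "\<bar>A x\<bar> * B y = \<bar>A y\<bar> * B x"
        using den(1)[OF xy(1)] den(1)[OF xy(2)] by (simp add: abs_mult)
      moreover have "(A x > 0) = (A y > 0)" using eq by (simp add: F_def)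
      ultimately have "A x * B y = A y * B x"
        by (auto simp: abs_if split: if_splits)
      then show "x = y" using frac_inj xy by blast
    qed
  qed
  also have "\<dots> = 2 * card T" by (simp add: card_cartesian_product)
  also have "card T \<le> Phi_tilde (real k) (card Q)"
    unfolding T_def by (rule card_split_smooth_le[OF finQ pr])
  finally show ?thesis by simp
qed

text \<open>One formula for three uses: \<open>C\<close> is \<open>A\<close>, \<open>B\<close> or
  the identity, giving numerator, denominator and integer representative of the same product.
  Exponents are multiples of 4, so that distinct ones differ by more than the bound 2 of
  \<open>minor_dichotomy\<close>. The last entry of \<open>l\<close> is slack, not an
  exponent.\<close>

definition twist :: "('v \<Rightarrow> int) \<Rightarrow> 'v list \<Rightarrow> 'v \<Rightarrow> nat list \<Rightarrow> int" where
  "twist C ws v l = C v * (\<Prod>j<length ws. C (ws ! j) ^ (4 * l ! j))"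

lemma twist_nonzero:
  assumes "v \<in> W" "set ws \<subseteq> W" "\<And>x. x \<in> W \<Longrightarrow> C x \<noteq> 0"
  shows "twist C ws v l \<noteq> 0"
  using assms by (auto simp: twist_def subset_iff)

lemma twist_bound:
  assumes "v \<in> W" "set ws \<subseteq> W" "\<And>x. x \<in> W \<Longrightarrow> \<bar>C x\<bar> \<le> int k" "k > 0"
    and "length l = Suc (length ws)" "sum_list l = R"
  shows "\<bar>twist C ws v l\<bar> \<le> int k ^ (4 * R + 1)"
proof -
  \<comment> \<open>Dropping the slack entry leaves exponents of total at most \<open>4 * R\<close>;
    the factor \<open>C v\<close> adds the 1.\<close>
  have "(\<Sum>j<length ws. l ! j) \<le> (\<Sum>j<Suc (length ws). l ! j)" by simp
  also have "\<dots> = R"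
    using assms(5,6) by (simp add: sum_list_sum_nth atLeast0LessThan)
  finally have sum: "(\<Sum>j<length ws. 4 * l ! j) \<le> 4 * R"
    by (simp flip: sum_distrib_left)
  have "(\<Prod>j<length ws. \<bar>C (ws ! j)\<bar> ^ (4 * l ! j)) \<le> (\<Prod>j<length ws. int k ^ (4 * l ! j))"
    using assms by (intro prod_mono conjI power_mono) (auto simp: subset_iff)
  also have "\<dots> = int k ^ (\<Sum>j<length ws. 4 * l ! j)" by (simp add: power_sum)
  also have "\<dots> \<le> int k ^ (4 * R)" using sum assms(4) by (intro power_increasing) auto
  finally have "\<bar>C v\<bar> * (\<Prod>j<length ws. \<bar>C (ws ! j)\<bar> ^ (4 * l ! j)) \<le> int k * int k ^ (4 * R)"
    using assms by (intro mult_mono) (auto intro!: prod_nonneg)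
  then show ?thesis by (simp add: twist_def abs_mult abs_prod power_abs)
qed

lemma frac_val_twist:
  assumes "prime q" "v \<in> W" "set ws \<subseteq> W"
  shows "frac_val q (twist A ws v l) (twist B ws v l) =
    val q v + (\<Sum>j<length ws. val q (ws ! j) * (4 * int (l ! j)))"
proof -
  have W: "ws ! j \<in> W" if "j < length ws" for j using that assms by auto
  show ?thesis
    unfolding twist_def using assms W
    by (subst frac_val_mult; simp add: num den_nonzero)
       (subst frac_val_prod; simp add: num den_nonzero frac_val_power mult_ac)
qed

text \<open>Valuations of equal fractions express the difference between \<open>v\<close> and
  \<open>v'\<close> through the \<open>ws\<close> with coefficients that are multiples of 4;
  \<open>indep\<close> bounds them by 2, so they vanish.\<close>

lemma twist_frac_inj:
  assumes ws: "set ws \<subseteq> W"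
    and indep: "\<And>v v' y j. \<lbrakk>v \<in> W; v' \<in> W; j < length ws;
         \<And>q. prime q \<Longrightarrow> val q v - val q v' = (\<Sum>i<length ws. val q (ws ! i) * y i)\<rbrakk> \<Longrightarrow> \<bar>y j\<bar> \<le> 2"
    and v: "v \<in> W" "v' \<in> W"
    and l: "length l = Suc (length ws)" "length l' = Suc (length ws)" "sum_list l = sum_list l'"
    and eq: "twist A ws v l * twist B ws v' l' = twist A ws v' l' * twist B ws v l"
  shows "v = v' \<and> l = l'"
proof -
  have "val q v - val q v' = (\<Sum>i<length ws. val q (ws ! i) * (4 * (int (l' ! i) - int (l ! i))))"
    if "prime q" for q
  proof -
    have "frac_val q (twist A ws v l) (twist B ws v l) = frac_val q (twist A ws v' l') (twist B ws v' l')"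
      using v ws that eq by (intro frac_val_eq_of_cross_eq twist_nonzero) (auto simp: num den_nonzero)
    then show ?thesis
      unfolding frac_val_twist[OF that v(1) ws] frac_val_twist[OF that v(2) ws]
      by (simp add: algebra_simps sum_subtractf)
  qed
  then have small: "\<bar>4 * (int (l' ! j) - int (l ! j))\<bar> \<le> 2" if "j < length ws" for j
    by (rule indep[OF v that, where y = "\<lambda>i. 4 * (int (l' ! i) - int (l ! i))"])
  have same: "l ! j = l' ! j" if "j < length ws" for j
    using small[OF that] by presburger
  \<comment> \<open>The equal totals now fix the slack entry as well.\<close>
  have "(\<Sum>j<Suc (length ws). l ! j) = (\<Sum>j<Suc (length ws). l' ! j)"
    using l by (simp only: sum_list_sum_nth atLeast0LessThan)
  moreover have "(\<Sum>j<length ws. l ! j) = (\<Sum>j<length ws. l' ! j)"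
    using same by (intro sum.cong) auto
  ultimately have "l ! length ws = l' ! length ws" by simp
  then have ll: "l = l'" using same l by (intro nth_equalityI) (auto simp: less_Suc_eq)
  have "ws ! j \<in> W" if "j < length ws" for j
    using that ws by auto
  then have "(\<Prod>j<length ws. A (ws ! j) ^ (4 * l ! j)) \<noteq> 0"
       "(\<Prod>j<length ws. B (ws ! j) ^ (4 * l ! j)) \<noteq> 0"
    using num den_nonzero by auto
  then have "A v * B v' = A v' * B v"
    using eq by (auto simp: twist_def ll mult_ac)
  then show ?thesis using frac_inj v ll by blast
qed

end

subsection \<open>Elements of small height in a subgroup\<close>

lemma subgroup_of_order_properties:
  assumes p: "prime p" and t: "t dvd p - 1"
  shows "card (subgroup_of_order p t) = t"
    and "subgroup_of_order p t \<subseteq> {0<..<int p}"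
    and "1 \<in> subgroup_of_order p t"
    and "\<lbrakk>x \<in> subgroup_of_order p t; y \<in> subgroup_of_order p t\<rbrakk>
      \<Longrightarrow> x * y mod int p \<in> subgroup_of_order p t"
proof -
  have G: "subgroup (subgroup_of_order p t) (mult_of (residue_ring (int p))) \<and>
      card (subgroup_of_order p t) = t"
    unfolding subgroup_of_order_def by (rule theI'[OF ex1_subgroup_of_order[OF p t]])
  then interpret subgroup "subgroup_of_order p t" "mult_of (residue_ring (int p))" by blast
  show "card (subgroup_of_order p t) = t" using G by blast
  show "subgroup_of_order p t \<subseteq> {0<..<int p}"
    using subset by (auto simp: residue_ring_def)
  show "1 \<in> subgroup_of_order p t"
    using one_closed by (simp add: residue_ring_def)
  show "\<lbrakk>x \<in> subgroup_of_order p t; y \<in> subgroup_of_order p t\<rbrakk>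
      \<Longrightarrow> x * y mod int p \<in> subgroup_of_order p t"
    using m_closed by (simp add: residue_ring_def)
qed

lemma rat_height_leD:
  assumes "rat_height p x \<le> k"
  shows "\<exists>a b. \<bar>a\<bar> \<le> int k \<and> 0 < b \<and> b \<le> int k \<and> [a = b * x] (mod int p)"
proof -
  define H where "H = {max (nat \<bar>a\<bar>) b | (a::int) (b::nat). b > 0 \<and> [a = int b * x] (mod int p)}"
  have "max (nat \<bar>x\<bar>) 1 \<in> H" unfolding H_def by (intro CollectI exI[of _ x] exI[of _ 1]) auto
  then have "rat_height p x \<in> H"
    unfolding rat_height_def H_def[symmetric] by (rule LeastI)
  then obtain a b where "rat_height p x = max (nat \<bar>a\<bar>) b" "b > 0" "[a = int b * x] (mod int p)"
    unfolding H_def by blast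
  then show ?thesis using assms by (intro exI[of _ a] exI[of _ "int b"]) auto
qed

text \<open>\<open>r2\<close> is made for this: cross products of two twists are bounded by
  \<open>k ^ (2 * (4 * R + 1))\<close>, so two of them differ by at most \<open>p\<close>; the 1/4
  supplies the 2 in the exponent.\<close>

lemma power_le_of_r2:
  assumes "p > 2" "k > 1" "int R = r2 p k"
  shows "2 * k ^ (8 * R + 2) \<le> p"
proof -
  have lnk: "ln (real k) > 0" using assms by simp
  have "real R \<le> ln (real p / 2) / (8 * ln (real k)) - 1 / 4"
    using assms(3) unfolding r2_def by linarith
  then have "real (8 * R + 2) * ln (real k) \<le> ln (real p / 2)"
    using lnk by (simp add: field_simps)
  then have "ln (real k ^ (8 * R + 2)) \<le> ln (real p / 2)"
    using assms by (subst ln_realpow) auto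
  then have "real k ^ (8 * R + 2) \<le> real p / 2"
    using assms by (subst (asm) ln_le_cancel_iff) auto
  then have "real (2 * k ^ (8 * R + 2)) \<le> real p" by simp
  then show ?thesis by (simp only: of_nat_le_iff)
qed

lemma r2_ge_minus_one:
  assumes "p > 2" "k > 1"
  shows "r2 p k \<ge> -1"
proof -
  have "ln (real p / 2) / (8 * ln (real k)) \<ge> 0" using assms by simp
  then show ?thesis unfolding r2_def by linarith
qed

text \<open>Division-free form of the bound. The binomial coefficient counts the exponent lists
  \<open>l\<close>, and the pairs of \<open>v\<close> and \<open>l\<close> are injected into the
  subgroup of order \<open>t\<close>.\<close>

lemma card_V_le_or_card_V_times_binomial_le:
  assumes p: "prime p" "p > 2" and t: "t dvd p - 1" and k: "k > 1"
    and size: "2 * k ^ (8 * R + 2) \<le> p"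
  shows "card (V p k t) \<le> 2 * Phi_tilde (real k) (s - 1) \<or>
    card (V p k t) * ((R + s) choose s) \<le> t"
proof -
  define G where "G = subgroup_of_order p t"
  define W where "W = V p k t"
  note G = subgroup_of_order_properties[OF p(1) t, folded G_def]
  have WG: "W \<subseteq> G" by (auto simp: W_def V_def G_def)
  have finG: "finite G" using G(2) finite_subset by blast
  have pI: "prime (int p)" using p by simp
  \<comment> \<open>An odd \<open>p\<close> makes the inequality \<open>size\<close> strict.\<close>
  have "odd p" using p prime_odd_nat by blast
  then have size': "2 * k ^ (8 * R + 2) < p"
    using size by (metis dvd_triv_left le_neq_implies_less)
  have "k ^ 1 \<le> k ^ (8 * R + 2)" using k by (intro power_increasing) auto
  then have kp: "k < p" using size' unfolding power_one_right by linarith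
  have "\<forall>x\<in>W. \<exists>a b. \<bar>a\<bar> \<le> int k \<and> 0 < b \<and> b \<le> int k \<and> [a = b * x] (mod int p)"
    using rat_height_leD by (auto simp: W_def V_def)
  then obtain A B where AB: "\<And>x. x \<in> W \<Longrightarrow>
      \<bar>A x\<bar> \<le> int k \<and> 0 < B x \<and> B x \<le> int k \<and> [A x = B x * x] (mod int p)"
    by metis
  have ndvd: "\<not> int p dvd b" if "0 < b" "b < int p" for b
    using that zdvd_imp_le by fastforce
  have ndvdB: "\<not> int p dvd B x" if "x \<in> W" for x
    using AB[OF that] kp by (intro ndvd) auto
  interpret bounded_fractions W A B k
  proof
    show "finite W" using finite_subset[OF WG finG] .
    show "A x \<noteq> 0" if "x \<in> W" for x
    proof
      assume "A x = 0"
      then have "int p dvd B x * x" using AB[OF that] by (metis cong_0_iff cong_sym)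
      then have "int p dvd x" using ndvdB[OF that] pI prime_dvd_mult_iff by blast
      then show False using ndvd[of x] G(2) WG that by auto
    qed
    \<comment> \<open>Equal fractions represent the same residue modulo \<open>p\<close>, and
      elements of \<open>G\<close> are their own residues between 1 and
      \<open>p - 1\<close>.\<close>
    show "x = y" if xy: "x \<in> W" "y \<in> W" and eq: "A x * B y = A y * B x" for x y
    proof -
      have "[A x * B y = B x * x * B y] (mod int p)" "[A y * B x = B y * y * B x] (mod int p)"
        using AB xy by (auto intro: cong_mult)
      then have "[B x * x * B y = B y * y * B x] (mod int p)"
        using eq by (metis cong_sym cong_trans)
      then have "int p dvd B x * B y * (x - y)"
        by (simp add: cong_iff_dvd_diff algebra_simps)
      then have "int p dvd x - y"
        using ndvdB xy pI by (simp add: prime_dvd_mult_iff)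
      then have "[x = y] (mod int p)" by (simp add: cong_iff_dvd_diff)
      moreover have "0 < x" "x < int p" "0 < y" "y < int p" using xy WG G(2) by auto
      ultimately show "x = y" by (simp add: cong_def)
    qed
  qed (use AB in auto)
  consider
    (determined) Q where "finite Q" "Q \<subseteq> {q. prime q}" "card Q < s"
      "\<And>v v' q. \<lbrakk>v \<in> W; v' \<in> W; q \<in> {q. prime q}; \<And>q'. q' \<in> Q \<Longrightarrow> val q' v = val q' v'\<rbrakk>
         \<Longrightarrow> val q v = val q v'"
  | (independent) ws where "length ws = s" "set ws \<subseteq> W"
      "\<And>v v' y j. \<lbrakk>v \<in> W; v' \<in> W; j < s;
         \<And>q. q \<in> {q. prime q} \<Longrightarrow> val q v - val q v' = (\<Sum>l<s. val q (ws ! l) * y l)\<rbrakk> \<Longrightarrow> \<bar>y j\<bar> \<le> 2"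
    by (rule minor_dichotomy[OF finite_W, of "{q. prime q}" s val]) (use that in blast)+
  then show ?thesis
  proof cases
    case determined
    \<comment> \<open>\<open>Q\<close> is padded to exactly \<open>s - 1\<close> primes, the index
      at which \<open>Phi_tilde\<close> is wanted.\<close>
    have "infinite ({q::nat. prime q} - Q)"
      using primes_infinite determined(1) by simp
    then obtain Q' where Q': "finite Q'" "card Q' = s - 1 - card Q" "Q' \<subseteq> {q. prime q} - Q"
      using infinite_arbitrarily_large by blast
    have "card (Q \<union> Q') = card Q + card Q'"
      using determined(1) Q' by (intro card_Un_disjoint) auto
    then have "card (Q \<union> Q') = s - 1" using determined(3) Q'(2) by simp
    moreover have "card W \<le> 2 * Phi_tilde (real k) (card (Q \<union> Q'))"
    proof (rule card_le_Phi_tilde)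
      show "val q x = val q y"
        if "x \<in> W" "y \<in> W" "prime q" "\<And>q'. q' \<in> Q \<union> Q' \<Longrightarrow> val q' x = val q' y" for x y q
        by (rule determined(4)) (use that in auto)
    qed (use determined Q' in auto)
    ultimately show ?thesis by (simp add: W_def)
  next
    case (independent ws)
    note len = independent(1) and ws = independent(2)
    have wsW: "ws ! j \<in> W" if "j < length ws" for j
      using that ws by auto
    \<comment> \<open>The last entry of \<open>l\<close> is the slack in \<open>e\<^sub>1 + \<dots> + e\<^sub>s \<le> R\<close>.\<close>
    define L where "L = {l::nat list. length l = Suc s \<and> sum_list l = R}"
    have "card L = (R + s) choose R"
      unfolding L_def card_length_sum_list by simp
    also have "\<dots> = (R + s) choose s" by (subst binomial_symmetric) auto
    finally have cardL: "card L = (R + s) choose s" .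
    define g where "g v l = twist (\<lambda>x. x) ws v l mod int p" for v l
    have gG: "g v l \<in> G" if v: "v \<in> W" for v l
    proof -
      define K where "K = {z. z mod int p \<in> G}"
      have mult: "a * b \<in> K" if "a \<in> K" "b \<in> K" for a b
        using G(4)[of "a mod int p" "b mod int p"] that by (simp add: K_def mod_mult_eq)
      have one: "1 \<in> K" using G(3) p by (simp add: K_def)
      have pow: "a ^ n \<in> K" if "a \<in> K" for a n
        by (induction n) (use that mult one in auto)
      have sub: "x \<in> K" if "x \<in> W" for x
        using that WG G(2) by (auto simp: K_def mod_pos_pos_trivial subset_iff)
      have "(\<Prod>j\<in>J. ws ! j ^ (4 * l ! j)) \<in> K" if "finite J" "J \<subseteq> {..<length ws}" for J
        using that
      proof (induction J rule: finite_induct)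
        case (insert x F)
        then have "ws ! x \<in> K" using sub wsW by simp
        then show ?case using insert by (simp add: mult pow)
      qed (use one in simp)
      then have "twist (\<lambda>x. x) ws v l \<in> K"
        unfolding twist_def using sub[OF v] mult by blast
      then show ?thesis by (simp add: g_def K_def)
    qed
    \<comment> \<open>\<open>g v l\<close> is the residue of the fraction
      \<open>twist A ws v l / twist B ws v l\<close>, written without inverses.\<close>
    have cong: "[twist A ws v l = twist B ws v l * g v l] (mod int p)" if v: "v \<in> W" for v l
    proof -
      have "[(\<Prod>j<length ws. A (ws ! j) ^ (4 * l ! j)) =
          (\<Prod>j<length ws. (B (ws ! j) * ws ! j) ^ (4 * l ! j))] (mod int p)"
        using AB[OF wsW] by (intro cong_prod cong_pow) auto
      then have "[twist A ws v l = B v * v * (\<Prod>j<length ws. (B (ws ! j) * ws ! j) ^ (4 * l ! j))] (mod int p)"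
        unfolding twist_def using AB[OF v] by (intro cong_mult) auto
      also have "B v * v * (\<Prod>j<length ws. (B (ws ! j) * ws ! j) ^ (4 * l ! j)) =
          twist B ws v l * twist (\<lambda>x. x) ws v l"
        by (simp add: twist_def power_mult_distrib prod.distrib mult_ac)
      also have "[\<dots> = twist B ws v l * g v l] (mod int p)"
        unfolding g_def by (simp add: cong_def mod_mult_right_eq)
      finally show ?thesis .
    qed
    have "inj_on (\<lambda>(v, l). g v l) (W \<times> L)"
    proof (rule inj_onI, clarsimp)
      fix v l v' l'
      assume v: "v \<in> W" "v' \<in> W" and l: "l \<in> L" "l' \<in> L" and eq: "g v l = g v' l'"
      let ?N = "twist A ws v l * twist B ws v' l'" and ?N' = "twist A ws v' l' * twist B ws v l"
      have "[?N = twist B ws v l * g v l * twist B ws v' l'] (mod int p)"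
        using cong[OF v(1)] by (intro cong_mult) auto
      moreover have "[?N' = twist B ws v' l' * g v' l' * twist B ws v l] (mod int p)"
        using cong[OF v(2)] by (intro cong_mult) auto
      ultimately have "[?N = ?N'] (mod int p)"
        using eq by (simp add: mult_ac) (metis cong_sym cong_trans)
      then have dvd: "int p dvd ?N - ?N'" by (simp add: cong_iff_dvd_diff)
      have absB: "\<bar>B x\<bar> \<le> int k" if "x \<in> W" for x
        using den[OF that] by simp
      have bd: "\<bar>twist C ws u m\<bar> \<le> int k ^ (4 * R + 1)"
        if "u \<in> W" "m \<in> L" "\<And>x. x \<in> W \<Longrightarrow> \<bar>C x\<bar> \<le> int k" for C u m
        by (rule twist_bound[OF that(1) ws that(3)]) (use that(2) len k in \<open>auto simp: L_def\<close>)
      have bd2: "\<bar>twist A ws u m * twist B ws u' m'\<bar> \<le> int k ^ (8 * R + 2)"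
        if "u \<in> W" "m \<in> L" "u' \<in> W" "m' \<in> L" for u m u' m'
      proof -
        have "\<bar>twist A ws u m * twist B ws u' m'\<bar> \<le> int k ^ (4 * R + 1) * int k ^ (4 * R + 1)"
          unfolding abs_mult using that num(2) absB by (intro mult_mono bd) auto
        also have "\<dots> = int k ^ (8 * R + 2)" by (simp flip: power_add)
        finally show ?thesis .
      qed
      \<comment> \<open>Both cross products are at most \<open>k ^ (8 * R + 2)\<close> in absolute
        value, so their difference is below \<open>p\<close> in size; being divisible by
        \<open>p\<close>, it is 0.\<close>
      have "int (2 * k ^ (8 * R + 2)) < int p" using size' by (simp only: of_nat_less_iff)
      then have "2 * int k ^ (8 * R + 2) < int p" by simp
      then have "\<bar>?N - ?N'\<bar> < int p"
        using bd2[OF v(1) l(1) v(2) l(2)] bd2[OF v(2) l(2) v(1) l(1)] by linarith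
      then have "?N = ?N'"
        using dvd zdvd_not_zless[of "\<bar>?N - ?N'\<bar>" "int p"] by force
      show "v = v' \<and> l = l'"
      proof (rule twist_frac_inj[OF ws _ v])
        show "\<bar>y j\<bar> \<le> 2"
          if "u \<in> W" "u' \<in> W" "j < length ws"
            "\<And>q. prime q \<Longrightarrow> val q u - val q u' = (\<Sum>i<length ws. val q (ws ! i) * y i)" for u u' y j
          by (rule independent(3)[OF that(1,2), where y = y]) (use that len in auto)
      qed (use l len \<open>?N = ?N'\<close> in \<open>auto simp: L_def\<close>)
    qed
    then have "card (W \<times> L) \<le> card G"
      by (rule card_inj_on_le) (use gG finG in auto)
    then show ?thesis by (simp add: card_cartesian_product cardL G(1) W_def)
  qed
qed

section \<open>From the integer bound to the extended reals\<close>

theorem theorem1p8: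
  fixes p t k s :: nat and r :: int
  assumes "prime p" and "p > 2"
    and "t > 0" and "t dvd p - 1"
    and "k > 1"
    and "s \<ge> 1"
    and "r = r2 p k"
  shows "ereal (real (card (V p k t))) \<le>
    max (ereal (2 * real (Phi_tilde (real k) (s - 1))))
        (inverse (ereal (real_of_int (r + int s) gchoose s)) * ereal (real t))"
proof (cases "r \<ge> 0")
  case True
  define R where "R = nat r"
  have R: "r = int R" using True by (simp add: R_def)
  define c where "c = (R + s) choose s"
  have c: "c > 0" by (simp add: c_def)
  have gc: "real_of_int (r + int s) gchoose s = real c"
    by (simp add: R c_def binomial_gbinomial)
  have "card (V p k t) \<le> 2 * Phi_tilde (real k) (s - 1) \<or> card (V p k t) * c \<le> t"
    unfolding c_def using assms R by (intro card_V_le_or_card_V_times_binomial_le power_le_of_r2) auto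
  then show ?thesis
  proof
    assume "card (V p k t) \<le> 2 * Phi_tilde (real k) (s - 1)"
    then have "real (card (V p k t)) \<le> real (2 * Phi_tilde (real k) (s - 1))"
      by (simp only: of_nat_le_iff)
    then show ?thesis by (simp add: le_max_iff_disj)
  next
    assume "card (V p k t) * c \<le> t"
    then have "real (card (V p k t) * c) \<le> real t" by (simp only: of_nat_le_iff)
    then have "real (card (V p k t)) \<le> inverse (real c) * real t"
      using c by (simp add: field_simps)
    then show ?thesis unfolding gc using c by (simp add: le_max_iff_disj)
  qed
next
  case False
  \<comment> \<open>Here \<open>(s - 1) choose s\<close> is 0, its inverse in \<open>ereal\<close>
    is \<infinity>, and \<open>t > 0\<close> keeps the product infinite, so the bound is
    trivial.\<close>
  then have "r = -1" using r2_ge_minus_one[of p k] assms by linarith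
  then have "real_of_int (r + int s) = real (s - 1)" using assms by simp
  then have "real_of_int (r + int s) gchoose s = real ((s - 1) choose s)"
    by (simp only: binomial_gbinomial)
  also have "\<dots> = 0" using assms(6) by (subst binomial_eq_0) auto
  finally have "real_of_int (r + int s) gchoose s = 0" .
  then show ?thesis using assms(3) by simp
qed

end
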